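(* Let $I=[0,1]$, let $\{I_i\}_i$ be a finite partition of $I$ (up to finitely many points) by open intervals, and let $T\colon \bigcup_i I_i\to I$ be a piecewise expanding map. Suppose that: - the Lebesgue measure $m$ on $I$ is $T$-invariant; - $T$ is linear (i.e. affine) on each branch $I_i$ and it has $k$ branches; - the transfer operator $L$ associated with $T$, with respect to $m$, preserves a Banach space of functions $B$ that is continuously embedded in $L^1(I)$, and the operator $L\colon B\to B$ is bounded; - there is $C\ge0$ such that for every interval $J\subset I$ we have $1_J\in B$ and $\|1_J\|_B\le C$. Then $$r_{ess}(L,B)\ \ge\ \frac1k,$$ and every $\lambda\in\mathbb{C}$ with $|\lambda|<1/k$ is an eigenvalue of $L$ on $B$ with an infinite-dimensional eigenspace.
   Context: Functions are complex-valued and identified when equal $m$-a.e.; intervals may be open, closed or half-open. The number of branches is the number of intervals $I_i$. Expanding: there is $\lambda_0>1$ with $|DT(x)|\ge\lambda_0$ for all $x\in\bigcup_i I_i$. Transfer operator: $L\colon L^1(I)\to L^1(I)$, $(L\phi)(x)=\sum_{T(y)=x}\phi(y)/|DT(y)|$; equivalently $\int \psi\, L\phi\,dm=\int (\psi\circ T)\,\phi\,dm$ for all $\psi\in L^\infty(I)$, $\phi\in L^1(I)$. A Banach space of functions continuously embedded in $L^1(I)$ is a complex linear subspace $B\subset L^1(I)$ with a complete norm $\|\cdot\|_B$ such that the inclusion into $L^1(I)$ is bounded. "$L$ preserves $B$" means $L(B)\subset B$. Essential spectral radius: $r_{ess}(L,B)$ is the infimum of the $r\ge0$ such that every point of the spectrum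 of $L\colon B\to B$ with modulus $>r$ is an isolated eigenvalue of finite algebraic multiplicity. *)

theory Defs
  imports "HOL-Analysis.Analysis"
begin

abbreviation unit_leb :: "real measure" where
  "unit_leb \<equiv> lebesgue_on {0..1}"

definition L1_eq :: "(real \<Rightarrow> complex) \<Rightarrow> (real \<Rightarrow> complex) \<Rightarrow> bool" where
  "L1_eq f g \<longleftrightarrow> integrable unit_leb f \<and> integrable unit_leb g \<and> (AE x in unit_leb. f x = g x)"

lemma part_equivp_L1_eq: "part_equivp L1_eq"
proof (rule part_equivpI)
  show "\<exists>f. L1_eq f f"
    by (rule exI[of _ "\<lambda>_. 0"]) (simp add: L1_eq_def)
  show "symp L1_eq"
    by (auto intro!: sympI simp: L1_eq_def elim: AE_mp)
  show "transp L1_eq"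
    by (rule transpI) (auto simp: L1_eq_def elim: eventually_elim2)
qed

quotient_type L1 = "real \<Rightarrow> complex" / partial: L1_eq
  by (rule part_equivp_L1_eq)

instantiation L1 :: ab_group_add
begin

lift_definition zero_L1 :: L1 is "\<lambda>_. 0"
  by (simp add: L1_eq_def)

lift_definition plus_L1 :: "L1 \<Rightarrow> L1 \<Rightarrow> L1" is "\<lambda>f g x. f x + g x"
  by (auto simp: L1_eq_def elim: eventually_elim2)

lift_definition minus_L1 :: "L1 \<Rightarrow> L1 \<Rightarrow> L1" is "\<lambda>f g x. f x - g x"
  by (auto simp: L1_eq_def elim: eventually_elim2)

lift_definition uminus_L1 :: "L1 \<Rightarrow> L1" is "\<lambda>f x. - f x"
  by (auto simp: L1_eq_def)

instance
  by standard (transfer; auto simp: L1_eq_def algebra_simps)+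

end

lift_definition scaleC :: "complex \<Rightarrow> L1 \<Rightarrow> L1" (infixr "*\<^sub>C" 75) is "\<lambda>c f x. c * f x"
  by (auto simp: L1_eq_def)

global_interpretation L1: vector_space scaleC
  by standard (transfer; auto simp: L1_eq_def algebra_simps)+

lift_definition L1_norm :: "L1 \<Rightarrow> real" is "\<lambda>f. LINT x|unit_leb. cmod (f x)"
  by (auto simp: L1_eq_def intro!: integral_cong_AE)

text \<open>The class of a function; meaningful for integrable functions.\<close>

abbreviation L1_class :: "(real \<Rightarrow> complex) \<Rightarrow> L1" where
  "L1_class \<equiv> abs_L1"

definition finite_dim :: "L1 set \<Rightarrow> bool" where
  "finite_dim V \<longleftrightarrow> (\<exists>S. finite S \<and> V \<subseteq> L1.span S)"

text \<open>The norm \<open>N\<close> of the space \<open>B\<close> is a total function, but only its values on \<open>B\<close> matter.\<close>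

definition norm_on :: "L1 set \<Rightarrow> (L1 \<Rightarrow> real) \<Rightarrow> bool" where
  "norm_on B N \<longleftrightarrow>
     (\<forall>f\<in>B. 0 \<le> N f \<and> (N f = 0 \<longleftrightarrow> f = 0)) \<and>
     (\<forall>f\<in>B. \<forall>g\<in>B. N (f + g) \<le> N f + N g) \<and>
     (\<forall>c. \<forall>f\<in>B. N (c *\<^sub>C f) = cmod c * N f)"

definition complete_norm_on :: "L1 set \<Rightarrow> (L1 \<Rightarrow> real) \<Rightarrow> bool" where
  "complete_norm_on B N \<longleftrightarrow>
     (\<forall>u :: nat \<Rightarrow> L1. range u \<subseteq> B \<longrightarrow>
        (\<forall>e>0. \<exists>M. \<forall>i\<ge>M. \<forall>j\<ge>M. N (u i - u j) < e) \<longrightarrow>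
        (\<exists>f\<in>B. (\<lambda>n. N (u n - f)) \<longlonglongrightarrow> 0))"

definition banach_function_space :: "L1 set \<Rightarrow> (L1 \<Rightarrow> real) \<Rightarrow> bool" where
  "banach_function_space B N \<longleftrightarrow>
     L1.subspace B \<and> norm_on B N \<and> complete_norm_on B N \<and>
     (\<exists>K. \<forall>f\<in>B. L1_norm f \<le> K * N f)"

definition bounded_on :: "L1 set \<Rightarrow> (L1 \<Rightarrow> real) \<Rightarrow> (L1 \<Rightarrow> L1) \<Rightarrow> bool" where
  "bounded_on B N A \<longleftrightarrow> (\<exists>K. \<forall>f\<in>B. N (A f) \<le> K * N f)"

text \<open>A two-sided inverse of a linear map is linear, so linearity of \<open>R\<close> need not be required.\<close>

definition spectrum_on :: "L1 set \<Rightarrow> (L1 \<Rightarrow> real) \<Rightarrow> (L1 \<Rightarrow> L1) \<Rightarrow> complex set" where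
  "spectrum_on B N A =
     {z. \<not> (\<exists>R. R ` B \<subseteq> B \<and> bounded_on B N R \<and>
              (\<forall>f\<in>B. R (A f - z *\<^sub>C f) = f \<and> A (R f) - z *\<^sub>C R f = f))}"

definition eigenspace_on :: "L1 set \<Rightarrow> (L1 \<Rightarrow> L1) \<Rightarrow> complex \<Rightarrow> L1 set" where
  "eigenspace_on B A z = {f \<in> B. A f = z *\<^sub>C f}"

definition eigenvalue_on :: "L1 set \<Rightarrow> (L1 \<Rightarrow> L1) \<Rightarrow> complex \<Rightarrow> bool" where
  "eigenvalue_on B A z \<longleftrightarrow> (\<exists>f\<in>B. f \<noteq> 0 \<and> A f = z *\<^sub>C f)"

text \<open>The algebraic multiplicity of an eigenvalue is the dimension of this space.\<close>

definition gen_eigenspace_on :: "L1 set \<Rightarrow> (L1 \<Rightarrow> L1) \<Rightarrow> complex \<Rightarrow> L1 set" where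
  "gen_eigenspace_on B A z = {f \<in> B. \<exists>n. ((\<lambda>g. A g - z *\<^sub>C g) ^^ n) f = 0}"

text \<open>
  The infimum is taken in the extended reals. It is finite for every bounded operator on a Banach
  space, since the spectrum is then bounded.
\<close>

definition ess_spectral_radius :: "L1 set \<Rightarrow> (L1 \<Rightarrow> real) \<Rightarrow> (L1 \<Rightarrow> L1) \<Rightarrow> ereal" where
  "ess_spectral_radius B N A =
     Inf {ereal r | r. 0 \<le> r \<and>
       (\<forall>z\<in>spectrum_on B N A. r < cmod z \<longrightarrow>
          z isolated_in spectrum_on B N A \<and> eigenvalue_on B A z \<and>
          finite_dim (gen_eigenspace_on B A z))}"

definition open_interval_partition :: "real set set \<Rightarrow> bool" where
  "open_interval_partition P \<longleftrightarrow>
     finite P \<and> disjoint P \<and>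
     (\<forall>J\<in>P. \<exists>a b. 0 \<le> a \<and> a < b \<and> b \<le> 1 \<and> J = {a<..<b}) \<and>
     finite ({0..1} - \<Union>P)"

text \<open>Only the values of \<open>T\<close> on \<open>\<Union>P\<close> matter; this set is open, so neither does \<open>deriv T\<close>
  there depend on other values.\<close>

definition piecewise_expanding :: "real set set \<Rightarrow> (real \<Rightarrow> real) \<Rightarrow> bool" where
  "piecewise_expanding P T \<longleftrightarrow>
     open_interval_partition P \<and> T ` \<Union>P \<subseteq> {0..1} \<and>
     (\<forall>x\<in>\<Union>P. T differentiable (at x)) \<and>
     (\<exists>c>1. \<forall>x\<in>\<Union>P. c \<le> \<bar>deriv T x\<bar>)"

definition piecewise_affine :: "real set set \<Rightarrow> (real \<Rightarrow> real) \<Rightarrow> bool" where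
  "piecewise_affine P T \<longleftrightarrow> (\<forall>J\<in>P. \<exists>a b. \<forall>x\<in>J. T x = a * x + b)"

definition lebesgue_invariant :: "real set set \<Rightarrow> (real \<Rightarrow> real) \<Rightarrow> bool" where
  "lebesgue_invariant P T \<longleftrightarrow>
     T \<in> lebesgue_on (\<Union>P) \<rightarrow>\<^sub>M unit_leb \<and> distr (lebesgue_on (\<Union>P)) unit_leb T = unit_leb"

text \<open>
  The sum is finite, because a piecewise expanding map is injective on each of its finitely many
  branches. Another choice of the representative \<open>rep_L1 \<phi>\<close> changes the sum only on a null set.
\<close>

definition transfer_operator :: "real set set \<Rightarrow> (real \<Rightarrow> real) \<Rightarrow> L1 \<Rightarrow> L1" where
  "transfer_operator P T \<phi> =
     L1_class (\<lambda>x. \<Sum>y | y \<in> \<Union>P \<and> T y = x. rep_L1 \<phi> y / complex_of_real \<bar>deriv T y\<bar>)"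

end

theory Submission
  imports Defs
begin

text \<open>
  Since Lebesgue measure is invariant, the Koopman operator \<open>U \<phi> = \<phi> \<circ> T\<close> satisfies \<open>L U = id\<close> and is
  an isometry of \<open>L\<^sup>1\<close>. If \<open>L \<phi> = 0\<close>, then \<open>f = (\<Sum>n. z\<^sup>n U\<^sup>n \<phi>)\<close> formally satisfies \<open>L f = z f\<close>, and
  \<open>\<phi> = f - z U f\<close> shows that \<open>f\<close> determines \<open>\<phi>\<close>. If \<open>\<phi>\<close> is a step function, then
  \<open>U\<^sup>n \<phi>\<close> is a combination of at most \<open>O(k\<^sup>n)\<close> indicators of intervals, because the preimage of an interval
  under \<open>T\<close> consists of at most \<open>k\<close> intervals; so the series converges in \<open>B\<close> for \<open>\<bar>z\<bar> < 1 / k\<close>.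
  Finally \<open>L 1 = 1\<close> with all weights \<open>1 / \<bar>DT\<bar>\<close> below \<open>1\<close> forces the images of two branches \<open>I\<close>, \<open>J\<close> to
  overlap, and for every interval \<open>K\<close> in the overlap \<open>L\<close> vanishes on
  \<open>\<bar>DT\<^sub>I\<bar> 1\<^bsub>I \<inter> T\<inverse> K\<^esub> - \<bar>DT\<^sub>J\<bar> 1\<^bsub>J \<inter> T\<inverse> K\<^esub>\<close>. Disjoint choices of \<open>K\<close> make the kernel, and hence every
  eigenspace with \<open>\<bar>z\<bar> < 1 / k\<close>, infinite-dimensional.
\<close>

subsection \<open>Eigenfunctions from a right inverse\<close>

lemma L1_norm_triangle: "L1_norm (f + g) \<le> L1_norm f + L1_norm g"
proof (transfer)
  fix f g :: "real \<Rightarrow> complex"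
  assume "L1_eq f f" "L1_eq g g"
  then have i: "integrable unit_leb f" "integrable unit_leb g"
    by (auto simp: L1_eq_def)
  then have "(LINT x|unit_leb. cmod (f x + g x)) \<le> (LINT x|unit_leb. cmod (f x) + cmod (g x))"
    by (intro integral_mono) (auto simp: norm_triangle_ineq)
  then show "(LINT x|unit_leb. cmod (f x + g x)) \<le> (LINT x|unit_leb. cmod (f x)) + (LINT x|unit_leb. cmod (g x))"
    using i by simp
qed

lemma L1_norm_nonneg: "0 \<le> L1_norm f"
  by transfer simp

lemma L1_norm_scaleC: "L1_norm (c *\<^sub>C f) = cmod c * L1_norm f"
  by transfer (simp add: norm_mult)

lemma L1_norm_eq_0: "L1_norm f = 0 \<Longrightarrow> f = 0"
  by transfer (auto simp: L1_eq_def integral_nonneg_eq_0_iff_AE)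

text \<open>The hypothesis concerns sums over indices, while independence of a set speaks of
  distinct vectors. Hence \<open>f\<close> is first shown to be injective; then
  \<open>card S + 1\<close> independent vectors in the span of \<open>S\<close> contradict the
  exchange bound.\<close>

lemma not_finite_dim_sequence:
  fixes f :: "nat \<Rightarrow> L1"
  assumes ind: "\<And>n c i. (\<Sum>j<n. c j *\<^sub>C f j) = 0 \<Longrightarrow> i < n \<Longrightarrow> c i = 0"
    and V: "range f \<subseteq> V"
  shows "\<not> finite_dim V"
proof
  assume "finite_dim V"
  then obtain S where S: "finite S" "V \<subseteq> L1.span S"
    by (auto simp: finite_dim_def)
  have inj: "inj f"
  proof (rule injI, rule ccontr)
    fix a b assume eq: "f a = f b" and ne: "a \<noteq> b"
    \<comment> \<open>These are the coefficients of the relation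
      \<open>f a - f b = 0\<close>.\<close>
    define c :: "nat \<Rightarrow> complex" where "c j = (if j = a then 1 else if j = b then -1 else 0)" for j
    have "(\<Sum>j<Suc (max a b). c j *\<^sub>C f j) = (\<Sum>j\<in>{a, b}. c j *\<^sub>C f j)"
      by (rule sum.mono_neutral_right) (auto simp: c_def)
    also have "\<dots> = 0"
      using eq ne by (simp add: c_def)
    finally have "c a = 0"
      using ind[where n = "Suc (max a b)" and c = c and i = a] by simp
    then show False by (simp add: c_def)
  qed
  define n where "n = Suc (card S)"
  have "L1.independent (f ` {..<n})"
  proof (rule L1.independent_if_scalars_zero)
    fix u x assume u: "(\<Sum>x\<in>f ` {..<n}. u x *\<^sub>C x) = 0" and "x \<in> f ` {..<n}"
    then obtain i where i: "i < n" "x = f i" by auto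
    have "(\<Sum>j<n. u (f j) *\<^sub>C f j) = 0"
      using u by (simp add: sum.reindex inj_on_subset[OF inj])
    from ind[OF this i(1)] i(2) show "u x = 0" by simp
  qed simp
  moreover have "f ` {..<n} \<subseteq> L1.span S"
    using V S by auto
  ultimately have "card (f ` {..<n}) \<le> card S"
    using L1.independent_span_bound[OF S(1)] by blast
  moreover have "card (f ` {..<n}) = n"
    by (simp add: card_image inj_on_subset[OF inj])
  ultimately show False by (simp add: n_def)
qed

section \<open>Abstract setting: a bounded operator with a right inverse\<close>

text \<open>\<open>U\<close> is controlled in the \<open>L1\<close> norm alone. That the orbit of a
  particular \<open>g\<close> under \<open>U\<close> stays in \<open>B\<close>, and how fast it
  grows there, enters as a hypothesis on that \<open>g\<close>.\<close>

locale transfer_koopman =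
  fixes B :: "L1 set" and N :: "L1 \<Rightarrow> real" and L U :: "L1 \<Rightarrow> L1"
  assumes B: "banach_function_space B N"
    and L_add: "L (f + g) = L f + L g" and L_scale: "L (c *\<^sub>C f) = c *\<^sub>C L f"
    and L_B: "f \<in> B \<Longrightarrow> L f \<in> B" and L_bounded: "bounded_on B N L"
    and U_add: "U (f + g) = U f + U g" and U_scale: "U (c *\<^sub>C f) = c *\<^sub>C U f"
    and U_norm: "L1_norm (U f) \<le> L1_norm f"
    and L_U: "L (U f) = f"
begin

sublocale L: Vector_Spaces.linear scaleC scaleC L
  by unfold_locales (auto simp: L_add L_scale)

sublocale U: Vector_Spaces.linear scaleC scaleC U
  by unfold_locales (auto simp: U_add U_scale)

lemma B_zero: "0 \<in> B" and B_add: "f \<in> B \<Longrightarrow> g \<in> B \<Longrightarrow> f + g \<in> B"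
  and B_diff: "f \<in> B \<Longrightarrow> g \<in> B \<Longrightarrow> f - g \<in> B"
  and B_scale: "f \<in> B \<Longrightarrow> c *\<^sub>C f \<in> B"
  and B_sum: "(\<And>i. i \<in> A \<Longrightarrow> h i \<in> B) \<Longrightarrow> sum h A \<in> B"
  and N_nonneg: "f \<in> B \<Longrightarrow> 0 \<le> N f"
  and N_eq_0: "f \<in> B \<Longrightarrow> N f = 0 \<longleftrightarrow> f = 0"
  and N_triangle: "f \<in> B \<Longrightarrow> g \<in> B \<Longrightarrow> N (f + g) \<le> N f + N g"
  and N_scale: "f \<in> B \<Longrightarrow> N (c *\<^sub>C f) = cmod c * N f"
  using B by (auto simp: banach_function_space_def norm_on_def L1.subspace_0 L1.subspace_add
      L1.subspace_diff L1.subspace_scale L1.subspace_sum)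

lemma N_sum: "(\<And>i. i \<in> A \<Longrightarrow> h i \<in> B) \<Longrightarrow> N (sum h A) \<le> (\<Sum>i\<in>A. N (h i))"
proof (induction A rule: infinite_finite_induct)
  case (insert x F)
  then have "N (h x + sum h F) \<le> N (h x) + N (sum h F)"
    by (intro N_triangle B_sum) auto
  with insert show ?case by fastforce
qed (use N_eq_0[OF B_zero] in auto)

lemma N_limit_unique:
  assumes "f \<in> B" and "\<And>n. N f \<le> e n" and "e \<longlonglongrightarrow> 0"
  shows "f = 0"
proof -
  have "N f \<le> 0"
    using assms(2,3) by (intro LIMSEQ_le_const) auto
  then show ?thesis
    using N_nonneg[OF assms(1)] N_eq_0[OF assms(1)] by linarith
qed

text \<open>Partial sums of the Neumann series of \<open>1 - z U\<close> applied to
  \<open>g\<close>.\<close>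

definition S :: "complex \<Rightarrow> L1 \<Rightarrow> nat \<Rightarrow> L1" where
  "S z g n = (\<Sum>i<n. z ^ i *\<^sub>C (U ^^ i) g)"

text \<open>Splitting off the first term instead of the last serves two purposes: \<open>L\<close>
  kills \<open>g\<close> and cancels \<open>U\<close>, and \<open>g\<close> can be recovered from
  two consecutive partial sums.\<close>

lemma S_Suc: "S z g (Suc n) = g + z *\<^sub>C U (S z g n)"
  unfolding S_def sum.lessThan_Suc_shift
  by (simp add: U.sum U.scale L1.scale_sum_right del: sum.lessThan_Suc)

lemma U_pow_sum: "(U ^^ i) (\<Sum>j\<in>A. c j *\<^sub>C g j) = (\<Sum>j\<in>A. c j *\<^sub>C (U ^^ i) (g j))"
  by (induction i) (auto simp: U.sum U.scale)

lemma S_sum: "S z (\<Sum>j\<in>A. c j *\<^sub>C g j) n = (\<Sum>j\<in>A. c j *\<^sub>C S z (g j) n)"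
  unfolding S_def U_pow_sum L1.scale_sum_right
  by (subst sum.swap) (simp add: mult.commute)

lemma L_S: "L g = 0 \<Longrightarrow> L (S z g (Suc n)) = z *\<^sub>C S z g n"
  by (simp add: S_Suc L_add L_scale L_U)

text \<open>By \<open>S_Suc\<close>, \<open>g\<close> is the difference of
  \<open>S z g (Suc n)\<close> and \<open>z\<close> times \<open>U (S z g n)\<close>. Convergence in
  \<open>N\<close> is first weakened to \<open>L1\<close> through the continuous embedding, because
  \<open>U\<close> is a contraction there.\<close>

lemma S_tendsto_0_imp:
  assumes S_B: "\<And>n. S z g n \<in> B" and lim: "(\<lambda>n. N (S z g n)) \<longlonglongrightarrow> 0"
  shows "g = 0"
proof -
  obtain K where K: "\<And>f. f \<in> B \<Longrightarrow> L1_norm f \<le> K * N f"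
    using B by (auto simp: banach_function_space_def)
  have "L1_norm g \<le> K * N (S z g (Suc n)) + cmod z * (K * N (S z g n))" for n
  proof -
    have "g = S z g (Suc n) + (- z) *\<^sub>C U (S z g n)"
      by (simp add: S_Suc)
    then have "L1_norm g \<le> L1_norm (S z g (Suc n)) + cmod z * L1_norm (U (S z g n))"
      using L1_norm_triangle[of "S z g (Suc n)" "(- z) *\<^sub>C U (S z g n)"]
      unfolding L1_norm_scaleC by simp
    also have "\<dots> \<le> L1_norm (S z g (Suc n)) + cmod z * L1_norm (S z g n)"
      by (intro add_left_mono mult_left_mono U_norm) auto
    also have "\<dots> \<le> K * N (S z g (Suc n)) + cmod z * (K * N (S z g n))"
      by (intro add_mono mult_left_mono K S_B) auto
    finally show ?thesis .
  qed
  moreover have "(\<lambda>n. K * N (S z g (Suc n)) + cmod z * (K * N (S z g n))) \<longlonglongrightarrow> K * 0 + cmod z * (K * 0)"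
    by (intro tendsto_intros lim LIMSEQ_Suc[OF lim])
  ultimately have "L1_norm g \<le> 0"
    by (intro LIMSEQ_le_const) auto
  then show ?thesis
    using L1_norm_nonneg[of g] by (intro L1_norm_eq_0) simp
qed

text \<open>The terms of the series are dominated by a geometric series with ratio
  \<open>cmod z * \<kappa>\<close>, so completeness of \<open>B\<close> yields a limit; continuity
  of \<open>L\<close> on \<open>B\<close> carries \<open>L_S\<close> over to it. Convergence is part
  of the conclusion because it is what later shows that the limits inherit linear
  independence.\<close>

lemma eigenfunction_series:
  assumes ker: "L g = 0" and U_B: "\<And>n. (U ^^ n) g \<in> B"
    and growth: "\<And>n. N ((U ^^ n) g) \<le> D * \<kappa> ^ n"
    and z: "cmod z * \<kappa> < 1" and \<kappa>: "0 \<le> \<kappa>"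
  shows "\<exists>f\<in>B. L f = z *\<^sub>C f \<and> (\<lambda>n. N (S z g n - f)) \<longlonglongrightarrow> 0"
proof -
  let ?q = "cmod z * \<kappa>"
  have S_B: "S z g n \<in> B" for n
    unfolding S_def by (intro B_sum B_scale U_B)
  have Sdiff: "N (S z g i - S z g j) \<le> (\<Sum>l=j..<i. D * ?q ^ l)" if "j \<le> i" for i j
  proof -
    have "S z g i - S z g j = (\<Sum>l=j..<i. z ^ l *\<^sub>C (U ^^ l) g)"
      using that sum_diff_nat_ivl[of 0 j i "\<lambda>l. z ^ l *\<^sub>C (U ^^ l) g"]
      by (simp add: S_def lessThan_atLeast0)
    then have "N (S z g i - S z g j) \<le> (\<Sum>l=j..<i. N (z ^ l *\<^sub>C (U ^^ l) g))"
      by (simp add: N_sum B_scale U_B)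
    also have "\<dots> \<le> (\<Sum>l=j..<i. D * ?q ^ l)"
    proof (rule sum_mono)
      fix l
      have "N (z ^ l *\<^sub>C (U ^^ l) g) = cmod z ^ l * N ((U ^^ l) g)"
        by (simp add: N_scale U_B norm_power)
      also have "\<dots> \<le> cmod z ^ l * (D * \<kappa> ^ l)"
        by (intro mult_left_mono growth) auto
      finally show "N (z ^ l *\<^sub>C (U ^^ l) g) \<le> D * ?q ^ l"
        by (simp add: power_mult_distrib algebra_simps)
    qed
    finally show ?thesis .
  qed
  \<comment> \<open>\<open>Sdiff\<close> treats one order of the two indices; this symmetry supplies
    the other.\<close>
  have N_comm: "N (f - h) = N (h - f)" if "f \<in> B" "h \<in> B" for f h
    using N_scale[OF B_diff[OF that], of "-1"] by simp
  have "summable (\<lambda>l. D * ?q ^ l)"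
    using z \<kappa> by (intro summable_mult summable_geometric) (auto simp: abs_mult)
  then have cauchy: "\<exists>M. \<forall>i\<ge>M. \<forall>j\<ge>M. N (S z g i - S z g j) < e" if "e > 0" for e
  proof -
    obtain M where M: "\<And>m n. m \<ge> M \<Longrightarrow> norm (\<Sum>l=m..<n. D * ?q ^ l) < e"
      using \<open>summable _\<close> \<open>e > 0\<close> unfolding summable_Cauchy by meson
    have *: "N (S z g i - S z g j) < e" if "j \<ge> M" "j \<le> i" for i j
      using Sdiff[OF that(2)] M[OF that(1), of i] by auto
    have "N (S z g i - S z g j) < e" if "i \<ge> M" "j \<ge> M" for i j
      using *[OF that(2), of i] *[OF that(1), of j] N_comm[OF S_B S_B, of i j] by linarith
    then show ?thesis by blast
  qed
  obtain f where f: "f \<in> B" and lim: "(\<lambda>n. N (S z g n - f)) \<longlonglongrightarrow> 0"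
    using B S_B cauchy unfolding banach_function_space_def complete_norm_on_def by blast
  obtain K where K: "\<And>h. h \<in> B \<Longrightarrow> N (L h) \<le> K * N h"
    using L_bounded by (auto simp: bounded_on_def)
  have "L f - z *\<^sub>C f = 0"
  proof (rule N_limit_unique)
    show "L f - z *\<^sub>C f \<in> B"
      by (intro B_diff B_scale L_B f)
    show "N (L f - z *\<^sub>C f) \<le> K * N (S z g (Suc n) - f) + cmod z * N (S z g n - f)" for n
    proof -
      \<comment> \<open>The terms in \<open>S\<close> on the right cancel by \<open>L_S\<close>,
        which shifts the index by one.\<close>
      have "L f - z *\<^sub>C f = (-1) *\<^sub>C L (S z g (Suc n) - f) + z *\<^sub>C (S z g n - f)"
        by (simp add: L.diff L_S[OF ker] L1.scale_right_diff_distrib)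
      also have "N \<dots> \<le> N ((-1) *\<^sub>C L (S z g (Suc n) - f)) + N (z *\<^sub>C (S z g n - f))"
        by (intro N_triangle B_scale L_B B_diff S_B f)
      also have "\<dots> = N (L (S z g (Suc n) - f)) + cmod z * N (S z g n - f)"
        by (subst (1 2) N_scale) (auto intro: L_B B_diff S_B f)
      also have "\<dots> \<le> K * N (S z g (Suc n) - f) + cmod z * N (S z g n - f)"
        by (intro add_right_mono K B_diff S_B f)
      finally show ?thesis .
    qed
    have "(\<lambda>n. K * N (S z g (Suc n) - f) + cmod z * N (S z g n - f)) \<longlonglongrightarrow> K * 0 + cmod z * 0"
      by (intro tendsto_intros lim LIMSEQ_Suc[OF lim])
    then show "(\<lambda>n. K * N (S z g (Suc n) - f) + cmod z * N (S z g n - f)) \<longlonglongrightarrow> 0"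
      by simp
  qed
  with f lim show ?thesis by auto
qed

text \<open>The passage from kernel element to eigenfunction is linear and injective: a vanishing
  combination of the limits forces the partial sums of the same combination of the
  \<open>g j\<close> to tend to 0, so that combination is 0 by
  \<open>S_tendsto_0_imp\<close>.\<close>

lemma eigenspace_infinite_dim:
  fixes g :: "nat \<Rightarrow> L1"
  assumes ker: "\<And>i. L (g i) = 0" and U_B: "\<And>i n. (U ^^ n) (g i) \<in> B"
    and growth: "\<And>i n. N ((U ^^ n) (g i)) \<le> D i * \<kappa> ^ n"
    and z: "cmod z * \<kappa> < 1" and \<kappa>: "0 \<le> \<kappa>"
    and ind: "\<And>n c i. (\<Sum>j<n. c j *\<^sub>C g j) = 0 \<Longrightarrow> i < n \<Longrightarrow> c i = 0"
  shows "\<not> finite_dim (eigenspace_on B L z)"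
proof -
  have "\<forall>i. \<exists>f. f \<in> B \<and> L f = z *\<^sub>C f \<and> (\<lambda>n. N (S z (g i) n - f)) \<longlonglongrightarrow> 0"
    using eigenfunction_series[OF ker U_B growth z \<kappa>] by blast
  then obtain f where f: "\<And>i. f i \<in> B" "\<And>i. L (f i) = z *\<^sub>C f i"
    and lim: "\<And>i. (\<lambda>n. N (S z (g i) n - f i)) \<longlonglongrightarrow> 0"
    by metis
  have S_B: "S z (g i) n \<in> B" for i n
    unfolding S_def by (intro B_sum B_scale U_B)
  show ?thesis
  proof (rule not_finite_dim_sequence)
    show "range f \<subseteq> eigenspace_on B L z"
      using f by (auto simp: eigenspace_on_def)
    fix m c i
    assume 0: "(\<Sum>j<m. c j *\<^sub>C f j) = 0" and i: "i < m"
    let ?g = "\<Sum>j<m. c j *\<^sub>C g j"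
    have "?g = 0"
    proof (rule S_tendsto_0_imp)
      show SB: "S z ?g n \<in> B" for n
        unfolding S_sum by (intro B_sum B_scale S_B)
      have bound: "N (S z ?g n) \<le> (\<Sum>j<m. cmod (c j) * N (S z (g j) n - f j))" for n
      proof -
        \<comment> \<open>Subtracting the vanishing combination of the \<open>f j\<close> makes
          every summand tend to 0.\<close>
        have "S z ?g n = (\<Sum>j<m. c j *\<^sub>C (S z (g j) n - f j))"
          unfolding S_sum L1.scale_right_diff_distrib sum_subtractf 0 by simp
        also have "N \<dots> \<le> (\<Sum>j<m. N (c j *\<^sub>C (S z (g j) n - f j)))"
          by (intro N_sum B_scale B_diff S_B f)
        also have "\<dots> = (\<Sum>j<m. cmod (c j) * N (S z (g j) n - f j))"
          by (intro sum.cong refl N_scale B_diff S_B f)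
        finally show ?thesis .
      qed
      have "(\<lambda>n. \<Sum>j<m. cmod (c j) * N (S z (g j) n - f j)) \<longlonglongrightarrow> (\<Sum>j<m. cmod (c j) * 0)"
        by (intro tendsto_intros lim)
      then have lim': "(\<lambda>n. \<Sum>j<m. cmod (c j) * N (S z (g j) n - f j)) \<longlonglongrightarrow> 0"
        by simp
      show "(\<lambda>n. N (S z ?g n)) \<longlonglongrightarrow> 0"
        by (rule tendsto_sandwich[OF _ _ tendsto_const lim'])
          (rule always_eventually allI N_nonneg SB bound)+
    qed
    from ind[OF this i] show "c i = 0" .
  qed
qed

end

section \<open>From infinite-dimensional eigenspaces to the essential spectral radius\<close>

text \<open>If an admissible \<open>r\<close> were below \<open>\<rho>\<close>, any real number
  strictly between them would be a spectral point whose eigenspace, and so generalized eigenspace,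
  has infinite dimension.\<close>

lemma ess_spectral_radius_ge:
  assumes "L1.subspace B" "0 \<le> \<rho>"
    and lin: "\<And>f g. A (f + g) = A f + A g"
    and inf: "\<And>z. cmod z < \<rho> \<Longrightarrow> \<not> finite_dim (eigenspace_on B A z)"
  shows "ereal \<rho> \<le> ess_spectral_radius B N A"
    and "cmod z < \<rho> \<Longrightarrow> eigenvalue_on B A z"
proof -
  have ev: "eigenvalue_on B A z" if "cmod z < \<rho>" for z
  proof -
    \<comment> \<open>An eigenspace without nonzero vectors lies in the span of the empty
      set.\<close>
    have "\<not> eigenspace_on B A z \<subseteq> L1.span {}"
      using inf[OF that] unfolding finite_dim_def by blast
    then show ?thesis
      by (auto simp: eigenvalue_on_def eigenspace_on_def)
  qed
  show "eigenvalue_on B A z" if "cmod z < \<rho>" for z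
    by (rule ev[OF that])
  have A0: "A 0 = 0"
    using lin[of 0 0] by simp
  show "ereal \<rho> \<le> ess_spectral_radius B N A"
    unfolding ess_spectral_radius_def
  proof (rule Inf_greatest, clarify)
    fix r :: real
    assume r: "0 \<le> r" and *: "\<forall>z\<in>spectrum_on B N A. r < cmod z \<longrightarrow>
          z isolated_in spectrum_on B N A \<and> eigenvalue_on B A z \<and> finite_dim (gen_eigenspace_on B A z)"
    show "ereal \<rho> \<le> ereal r"
    proof (rule ccontr)
      assume "\<not> ereal \<rho> \<le> ereal r"
      then obtain s where s: "r < s" "s < \<rho>"
        using dense[of r \<rho>] by auto
      define z where "z = complex_of_real s"
      have z: "cmod z < \<rho>" "r < cmod z"
        using s r by (auto simp: z_def)
      obtain f where f: "f \<in> B" "f \<noteq> 0" "A f = z *\<^sub>C f"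
        using ev[OF z(1)] by (auto simp: eigenvalue_on_def)
      have "z \<in> spectrum_on B N A"
        unfolding spectrum_on_def
      proof (clarify)
        fix R assume R: "\<forall>f\<in>B. R (A f - z *\<^sub>C f) = f \<and> A (R f) - z *\<^sub>C R f = f"
        have "0 \<in> B" using assms(1) by (rule L1.subspace_0)
        \<comment> \<open>The inverse identity at 0 gives this without linearity of
          \<open>R\<close>; at the eigenvector \<open>f\<close> the same identity reads
          \<open>R 0 = f\<close>, contradicting \<open>f \<noteq> 0\<close>.\<close>
        then have "R 0 = 0" using R A0 by force
        with R f show False by force
      qed
      then have "finite_dim (gen_eigenspace_on B A z)"
        using * z by blast
      moreover have "eigenspace_on B A z \<subseteq> gen_eigenspace_on B A z"
        by (auto simp: eigenspace_on_def gen_eigenspace_on_def intro!: exI[of _ 1])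
      ultimately show False
        using inf[OF z(1)] by (auto simp: finite_dim_def)
    qed
  qed
qed

subsection \<open>Classes of integrable functions\<close>

lemma integrable_rep_L1: "integrable unit_leb (rep_L1 f)"
  using Quotient_rep_reflp[OF Quotient_L1, of f] by (simp add: L1_eq_def)

lemma L1_class_rep: "L1_class (rep_L1 f) = f"
  by (rule Quotient_abs_rep[OF Quotient_L1])

lemma rep_L1_class: "integrable unit_leb f \<Longrightarrow> AE x in unit_leb. rep_L1 (L1_class f) x = f x"
  using Quotient_rep_abs[OF Quotient_L1, of f] by (simp add: L1_eq_def)

lemma L1_class_eq_iff:
  "integrable unit_leb f \<Longrightarrow> integrable unit_leb g \<Longrightarrow>
     L1_class f = L1_class g \<longleftrightarrow> (AE x in unit_leb. f x = g x)"
  using Quotient_rel[OF Quotient_L1, of f g] by (simp add: L1_eq_def)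

lemma L1_class_zero: "L1_class (\<lambda>_. 0) = 0"
  by (simp add: zero_L1.abs_eq)

lemma L1_class_add:
  "integrable unit_leb f \<Longrightarrow> integrable unit_leb g \<Longrightarrow>
     L1_class (\<lambda>x. f x + g x) = L1_class f + L1_class g"
  by (subst plus_L1.abs_eq) (auto simp: L1_eq_def)

lemma L1_class_diff:
  "integrable unit_leb f \<Longrightarrow> integrable unit_leb g \<Longrightarrow>
     L1_class (\<lambda>x. f x - g x) = L1_class f - L1_class g"
  by (subst minus_L1.abs_eq) (auto simp: L1_eq_def)

lemma L1_class_scale:
  "integrable unit_leb f \<Longrightarrow> L1_class (\<lambda>x. c * f x) = c *\<^sub>C L1_class f"
  by (subst scaleC.abs_eq) (auto simp: L1_eq_def)

lemma L1_class_sum: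
  "(\<And>i. i \<in> A \<Longrightarrow> integrable unit_leb (f i)) \<Longrightarrow>
     L1_class (\<lambda>x. \<Sum>i\<in>A. f i x) = (\<Sum>i\<in>A. L1_class (f i))"
  by (induction A rule: infinite_finite_induct) (auto simp: L1_class_zero L1_class_add)

lemma L1_norm_class: "integrable unit_leb f \<Longrightarrow> L1_norm (L1_class f) = (LINT x|unit_leb. cmod (f x))"
  by (subst L1_norm.abs_eq) (auto simp: L1_eq_def)

text \<open>Extension by zero moves integrals to the whole line, where affine substitutions can be
  applied.\<close>

lemma integrable_unit_leb_iff:
  fixes f :: "real \<Rightarrow> 'a::{banach, second_countable_topology}"
  shows "integrable unit_leb f \<longleftrightarrow> integrable lebesgue (\<lambda>x. indicator {0..1} x *\<^sub>R f x)"
  by (rule integrable_restrict_space) simp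

lemma integrable_indicator_unit_leb:
  assumes "A \<in> sets lebesgue"
  shows "integrable unit_leb (indicator A :: real \<Rightarrow> complex)"
proof -
  have "emeasure lebesgue (A \<inter> {0..1}) < \<infinity>"
    using assms emeasure_mono[of "A \<inter> {0..1}" "{0..1}" lebesgue]
    by (auto simp: less_top[symmetric] top_unique)
  then have "integrable lebesgue (\<lambda>x. of_real (indicat_real (A \<inter> {0..1}) x) :: complex)"
    using assms by (intro integrable_of_real integrable_real_indicator) auto
  moreover have "(\<lambda>x. of_real (indicat_real (A \<inter> {0..1}) x)) =
      (\<lambda>x. indicator {0..1} x *\<^sub>R (indicator A x :: complex))"
    by (auto simp: indicator_def)
  ultimately show ?thesis
    unfolding integrable_unit_leb_iff by simp
qed

lemma integrable_unit_lebI: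
  fixes f :: "real \<Rightarrow> 'a::{banach, second_countable_topology}"
  shows "integrable lebesgue f \<Longrightarrow> integrable unit_leb f"
  unfolding integrable_unit_leb_iff by (rule integrable_mult_indicator) auto

lemma AE_unit_leb_iff: "(AE x in unit_leb. Q x) \<longleftrightarrow> (AE x in lebesgue. x \<in> {0..1} \<longrightarrow> Q x)"
  by (rule AE_restrict_space_iff) simp

text \<open>Lebesgue measure is its image under the affine map scaled by the positive constant
  \<open>\<bar>c\<bar>\<close>, so preimages of null sets are null.\<close>

lemma AE_lebesgue_affine:
  assumes "AE x in lebesgue. Q x" and "c \<noteq> (0::real)"
  shows "AE x in lebesgue. Q (t + c * x)"
proof -
  have m: "(\<lambda>x. t + c * x) \<in> lebesgue \<rightarrow>\<^sub>M lebesgue"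
    using lebesgue_affine_measurable[of "\<lambda>_. c" t] assms(2) by simp
  have "AE x in density (distr lebesgue lebesgue (\<lambda>x. t + c * x)) (\<lambda>_. ennreal \<bar>c\<bar>). Q x"
    using assms(1) unfolding lebesgue_real_affine[OF assms(2), of t, symmetric] .
  then have "AE x in distr lebesgue lebesgue (\<lambda>x. t + c * x). Q x"
    using assms(2) by (subst (asm) AE_density) auto
  then show ?thesis
    by (rule AE_distrD[OF m])
qed

subsection \<open>The transfer operator of an affine map\<close>

lemma deriv_affine_on_open:
  fixes f :: "real \<Rightarrow> real"
  assumes "open S" "x \<in> S" and f: "\<And>y. y \<in> S \<Longrightarrow> f y = a * y + b"
  shows "deriv f x = a"
proof (rule DERIV_imp_deriv)
  have "((\<lambda>x. a * x + b) has_field_derivative a) (at x)"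
    by (auto intro!: derivative_eq_intros)
  then show "(f has_field_derivative a) (at x)"
    by (rule has_field_derivative_transform_within_open[OF _ assms(1,2)]) (simp add: f)
qed

text \<open>Expansion is expressed through the slopes \<open>a J\<close>, since their reciprocals
  are the weights of the transfer operator and every single weight has to be below 1.\<close>

locale expanding_affine_map =
  fixes P :: "real set set" and T :: "real \<Rightarrow> real" and a b :: "real set \<Rightarrow> real"
  assumes partition: "open_interval_partition P"
    and T_affine: "\<And>J x. J \<in> P \<Longrightarrow> x \<in> J \<Longrightarrow> T x = a J * x + b J"
    and expanding: "\<And>J. J \<in> P \<Longrightarrow> 1 < \<bar>a J\<bar>"
    and invariant: "lebesgue_invariant P T"
begin

lemma finite_P: "finite P"
  using partition by (simp add: open_interval_partition_def)

lemma branch_unique: "J \<in> P \<Longrightarrow> J' \<in> P \<Longrightarrow> x \<in> J \<Longrightarrow> x \<in> J' \<Longrightarrow> J = J'"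
  using partition by (auto simp: open_interval_partition_def pairwise_def disjnt_def)

lemma branch_interval:
  assumes "J \<in> P"
  obtains l u where "0 \<le> l" "l < u" "u \<le> 1" "J = {l<..<u}"
  using assms partition by (auto simp: open_interval_partition_def)

lemma branch_subset: "J \<in> P \<Longrightarrow> J \<subseteq> {0..1}" and branch_open: "J \<in> P \<Longrightarrow> open J"
  by (auto elim!: branch_interval)

lemma slope_nonzero: "J \<in> P \<Longrightarrow> a J \<noteq> 0"
  using expanding[of J] by auto

lemma deriv_T: "J \<in> P \<Longrightarrow> x \<in> J \<Longrightarrow> deriv T x = a J"
  by (rule deriv_affine_on_open[OF branch_open _ T_affine])

text \<open>The inverse of the affine formula of \<open>J\<close>, extended to the whole line. The
  test \<open>inv_branch J x \<in> J\<close> therefore says that \<open>x\<close> lies in the image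
  of the branch.\<close>

definition inv_branch :: "real set \<Rightarrow> real \<Rightarrow> real" where
  "inv_branch J x = - b J / a J + (1 / a J) * x"

lemma inv_branch_iff: "J \<in> P \<Longrightarrow> y \<in> J \<and> T y = x \<longleftrightarrow> inv_branch J x \<in> J \<and> y = inv_branch J x"
  using T_affine[of J] slope_nonzero[of J] by (auto simp: inv_branch_def field_simps)

definition transfer_fun :: "(real \<Rightarrow> complex) \<Rightarrow> real \<Rightarrow> complex" where
  "transfer_fun f x = (\<Sum>y | y \<in> \<Union>P \<and> T y = x. f y / complex_of_real \<bar>deriv T y\<bar>)"

lemma transfer_operator_eq: "transfer_operator P T \<phi> = L1_class (transfer_fun (rep_L1 \<phi>))"
  by (simp add: transfer_operator_def transfer_fun_def[abs_def])

text \<open>Each fibre of \<open>T\<close> meets a branch in at most one point. The sum over a fibre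
  thus becomes a sum over a fixed finite index set, which gives access to integrability and null
  sets.\<close>

lemma transfer_fun_eq:
  "transfer_fun f x =
     (\<Sum>J\<in>P. if inv_branch J x \<in> J then f (inv_branch J x) / complex_of_real \<bar>a J\<bar> else 0)"
proof -
  have *: "{y. y \<in> J \<and> T y = x} = (if inv_branch J x \<in> J then {inv_branch J x} else {})" if "J \<in> P" for J
    using inv_branch_iff[OF that, of _ x] by auto
  have "{y. y \<in> \<Union>P \<and> T y = x} = (\<Union>J\<in>P. {y. y \<in> J \<and> T y = x})"
    by auto
  then have "transfer_fun f x = (\<Sum>J\<in>P. \<Sum>y | y \<in> J \<and> T y = x. f y / complex_of_real \<bar>deriv T y\<bar>)"
    unfolding transfer_fun_def
    by (simp only:) (rule sum.UNION_disjoint, auto simp: finite_P * dest: branch_unique)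
  also have "\<dots> = (\<Sum>J\<in>P. if inv_branch J x \<in> J then f (inv_branch J x) / complex_of_real \<bar>a J\<bar> else 0)"
    by (intro sum.cong refl) (auto simp: * deriv_T)
  finally show ?thesis .
qed

lemma transfer_fun_integrable:
  assumes "integrable unit_leb f"
  shows "integrable unit_leb (transfer_fun f)"
proof -
  have "integrable unit_leb (\<lambda>x. if inv_branch J x \<in> J then f (inv_branch J x) / complex_of_real \<bar>a J\<bar> else 0)"
    if "J \<in> P" for J
  proof -
    have "integrable lebesgue (\<lambda>x. indicator J x *\<^sub>R (indicator {0..1} x *\<^sub>R f x))"
      using assms borel_open[OF branch_open[OF that]] unfolding integrable_unit_leb_iff
      by (intro integrable_mult_indicator[where A = J]) simp_all
    then have "integrable lebesgue (\<lambda>x. (indicator J x *\<^sub>R (indicator {0..1} x *\<^sub>R f x)) / of_real \<bar>a J\<bar>)"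
      by (rule integrable_divide)
    \<comment> \<open>The summand belonging to \<open>J\<close> is an integrable function supported
      on \<open>J\<close>, composed with an affine bijection.\<close>
    then have "integrable lebesgue (\<lambda>x. (indicator J (inv_branch J x) *\<^sub>R
        (indicator {0..1} (inv_branch J x) *\<^sub>R f (inv_branch J x))) / of_real \<bar>a J\<bar>)"
      unfolding inv_branch_def using slope_nonzero[OF that]
      by (intro lebesgue_integrable_real_affine) auto
    also have "(\<lambda>x. (indicator J (inv_branch J x) *\<^sub>R
        (indicator {0..1} (inv_branch J x) *\<^sub>R f (inv_branch J x))) / of_real \<bar>a J\<bar>) =
      (\<lambda>x. if inv_branch J x \<in> J then f (inv_branch J x) / complex_of_real \<bar>a J\<bar> else 0)"
      using branch_subset[OF that] by (auto simp: indicator_def fun_eq_iff)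
    finally show ?thesis
      by (rule integrable_unit_lebI)
  qed
  then show ?thesis
    unfolding transfer_fun_eq[abs_def] by (intro Bochner_Integration.integrable_sum)
qed

text \<open>The exceptional null set is pulled back along finitely many affine bijections. This is
  what allows the transfer operator to be computed on any integrable representative.\<close>

lemma transfer_fun_cong_AE:
  assumes "AE x in unit_leb. f x = g x"
  shows "AE x in unit_leb. transfer_fun f x = transfer_fun g x"
proof -
  have "AE x in lebesgue. inv_branch J x \<in> J \<longrightarrow> f (inv_branch J x) = g (inv_branch J x)"
    if "J \<in> P" for J
    unfolding inv_branch_def
  proof (rule AE_lebesgue_affine)
    show "AE x in lebesgue. x \<in> J \<longrightarrow> f x = g x"
      using assms branch_subset[OF that] unfolding AE_unit_leb_iff by (auto elim!: eventually_mono)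
  qed (use slope_nonzero[OF that] in simp)
  then have "AE x in lebesgue. \<forall>J\<in>P. inv_branch J x \<in> J \<longrightarrow> f (inv_branch J x) = g (inv_branch J x)"
    using finite_P by (simp add: AE_finite_all)
  then show ?thesis
    unfolding AE_unit_leb_iff transfer_fun_eq
    by (rule eventually_mono) (auto intro!: sum.cong)
qed

lemma transfer_operator_class:
  assumes "integrable unit_leb f"
  shows "transfer_operator P T (L1_class f) = L1_class (transfer_fun f)"
  unfolding transfer_operator_eq
  using assms
  by (simp add: L1_class_eq_iff transfer_fun_integrable integrable_rep_L1
      transfer_fun_cong_AE[OF rep_L1_class])

lemma transfer_operator_add:
  "transfer_operator P T (\<phi> + \<psi>) = transfer_operator P T \<phi> + transfer_operator P T \<psi>"
proof -
  let ?f = "rep_L1 \<phi>" and ?g = "rep_L1 \<psi>"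
  have "transfer_operator P T (L1_class ?f + L1_class ?g) = L1_class (transfer_fun (\<lambda>x. ?f x + ?g x))"
    by (simp add: L1_class_add[symmetric] integrable_rep_L1 transfer_operator_class)
  also have "transfer_fun (\<lambda>x. ?f x + ?g x) = (\<lambda>x. transfer_fun ?f x + transfer_fun ?g x)"
    by (simp add: transfer_fun_def fun_eq_iff add_divide_distrib sum.distrib)
  finally show ?thesis
    by (simp add: L1_class_add transfer_fun_integrable integrable_rep_L1 L1_class_rep
        transfer_operator_eq)
qed

lemma transfer_operator_scale:
  "transfer_operator P T (c *\<^sub>C \<phi>) = c *\<^sub>C transfer_operator P T \<phi>"
proof -
  let ?f = "rep_L1 \<phi>"
  have "transfer_operator P T (c *\<^sub>C L1_class ?f) = L1_class (transfer_fun (\<lambda>x. c * ?f x))"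
    by (simp add: L1_class_scale[symmetric] integrable_rep_L1 transfer_operator_class)
  also have "transfer_fun (\<lambda>x. c * ?f x) = (\<lambda>x. c * transfer_fun ?f x)"
    by (simp add: transfer_fun_def fun_eq_iff sum_distrib_left)
  finally show ?thesis
    by (simp add: L1_class_scale transfer_fun_integrable integrable_rep_L1 L1_class_rep
        transfer_operator_eq)
qed

lemma transfer_indicator:
  assumes "J \<in> P" and K: "K \<subseteq> T ` J"
  shows "transfer_fun (indicator (J \<inter> T -` K)) x = indicator K x / complex_of_real \<bar>a J\<bar>"
proof -
  have "transfer_fun (indicator (J \<inter> T -` K)) x =
      (\<Sum>J'\<in>{J}. if inv_branch J' x \<in> J' then indicator (J \<inter> T -` K) (inv_branch J' x) / complex_of_real \<bar>a J'\<bar> else 0)"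
    unfolding transfer_fun_eq
    using finite_P assms(1)
    by (intro sum.mono_neutral_right) (auto simp: indicator_def dest: branch_unique)
  also have "\<dots> = indicator K x / complex_of_real \<bar>a J\<bar>"
  proof (cases "inv_branch J x \<in> J")
    case True
    then have "T (inv_branch J x) = x"
      using inv_branch_iff[OF assms(1), of "inv_branch J x" x] by simp
    with True show ?thesis
      by (simp add: indicator_def)
  next
    case False
    then have "x \<notin> K"
      using inv_branch_iff[OF assms(1), of _ x] K by blast
    with False show ?thesis
      by simp
  qed
  finally show ?thesis .
qed

section \<open>Invariance of Lebesgue measure as a condition on weights\<close>

text \<open>The transfer operator applied to the constant 1, in real form; equivalently, the density
  of the image of Lebesgue measure under \<open>T\<close>.\<close>

definition branch_weight :: "real \<Rightarrow> real" where
  "branch_weight x = (\<Sum>J\<in>P. if inv_branch J x \<in> J then 1 / \<bar>a J\<bar> else 0)"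

lemma UP_subset: "\<Union>P \<subseteq> {0..1}"
  using branch_subset by blast

lemma UP_sets: "\<Union>P \<in> sets lebesgue"
  by (rule sets_completionI_sets) (simp add: borel_open open_Union branch_open)

lemma T_measurable: "T \<in> lebesgue_on (\<Union>P) \<rightarrow>\<^sub>M unit_leb"
  and distr_T: "distr (lebesgue_on (\<Union>P)) unit_leb T = unit_leb"
  using invariant by (auto simp: lebesgue_invariant_def)

lemma inv_branch_measurable: "J \<in> P \<Longrightarrow> {x. inv_branch J x \<in> J} \<in> sets borel"
  by (rule borel_open, unfold inv_branch_def, rule open_vimage[OF branch_open, unfolded vimage_def])
    (auto intro!: continuous_intros dest: slope_nonzero)

lemma branch_weight_measurable: "branch_weight \<in> borel_measurable unit_leb"
proof -
  have "(\<lambda>x. if inv_branch J x \<in> J then 1 / \<bar>a J\<bar> else 0) \<in> borel_measurable borel" if "J \<in> P" for J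
    using inv_branch_measurable[OF that] by (intro measurable_If) auto
  then have "branch_weight \<in> borel_measurable borel"
    unfolding branch_weight_def[abs_def] by (intro borel_measurable_sum)
  then show ?thesis
    by (intro measurable_restrict_space1 measurable_completion) simp
qed

text \<open>In the substitution \<open>x = T y\<close> on \<open>J\<close> the Jacobian
  \<open>\<bar>a J\<bar>\<close> cancels the weight.\<close>

lemma branch_nn_integral:
  assumes J: "J \<in> P" and A: "A \<in> sets lebesgue" "A \<subseteq> {0..1}"
  shows "(\<integral>\<^sup>+x. ennreal (if inv_branch J x \<in> J then 1 / \<bar>a J\<bar> else 0) * indicator A x \<partial>unit_leb)
    = emeasure lebesgue (J \<inter> T -` A)"
proof -
  let ?w = "\<lambda>x. ennreal (if inv_branch J x \<in> J then 1 / \<bar>a J\<bar> else 0) * indicator A x"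
  have [measurable]: "Measurable.pred lebesgue (\<lambda>x. inv_branch J x \<in> J)"
    using inv_branch_measurable[OF J] by (simp add: pred_def)
  have w: "?w \<in> borel_measurable lebesgue"
    using A(1) by measurable
  have inv: "inv_branch J (b J + a J * x) = x" for x
    using slope_nonzero[OF J] by (simp add: inv_branch_def field_simps)
  have "J \<inter> T -` A = (\<lambda>x. b J + a J * x) -` (A \<inter> {x. inv_branch J x \<in> J}) \<inter> space lebesgue"
    using T_affine[OF J] by (auto simp: inv add.commute)
  also have "\<dots> \<in> sets lebesgue"
    using lebesgue_affine_measurable[of "\<lambda>_. a J" "b J"] slope_nonzero[OF J] A(1)
      inv_branch_measurable[OF J]
    by (intro measurable_sets[of _ lebesgue lebesgue]) auto
  finally have sets: "J \<inter> T -` A \<in> sets lebesgue" .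
  have "(\<integral>\<^sup>+x. ?w x \<partial>unit_leb) = (\<integral>\<^sup>+x. ?w x \<partial>lebesgue)"
    using A(2) by (subst nn_integral_restrict_space) (auto intro!: nn_integral_cong simp: indicator_def)
  also have "\<dots> = ennreal \<bar>a J\<bar> * (\<integral>\<^sup>+x. ?w (b J + a J * x) \<partial>lebesgue)"
    by (rule nn_integral_real_affine_lebesgue[OF w slope_nonzero[OF J]])
  also have "(\<lambda>x. ?w (b J + a J * x)) = (\<lambda>x. ennreal (1 / \<bar>a J\<bar>) * indicator (J \<inter> T -` A) x)"
    using T_affine[OF J] by (auto simp: inv indicator_def add.commute fun_eq_iff)
  also have "(\<integral>\<^sup>+x. ennreal (1 / \<bar>a J\<bar>) * indicator (J \<inter> T -` A) x \<partial>lebesgue)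
      = ennreal (1 / \<bar>a J\<bar>) * emeasure lebesgue (J \<inter> T -` A)"
    using sets by (rule nn_integral_cmult_indicator)
  also have "ennreal \<bar>a J\<bar> * (ennreal (1 / \<bar>a J\<bar>) * emeasure lebesgue (J \<inter> T -` A))
      = emeasure lebesgue (J \<inter> T -` A)"
    using slope_nonzero[OF J] by (simp add: mult.assoc[symmetric] ennreal_mult'[symmetric])
  finally show ?thesis .
qed

text \<open>Summing \<open>branch_nn_integral\<close> over the branches shows that the weight
  integrates over \<open>A\<close> to the measure of the preimage of \<open>A\<close>, which is the
  measure of \<open>A\<close> by invariance. Densities with respect to a finite measure are unique
  almost everywhere.\<close>

lemma AE_branch_weight: "AE x in unit_leb. branch_weight x = 1"
proof -
  interpret finite_measure unit_leb
    by (rule finite_measureI) (auto simp: emeasure_restrict_space)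
  have weight: "ennreal (branch_weight x) =
      (\<Sum>J\<in>P. ennreal (if inv_branch J x \<in> J then 1 / \<bar>a J\<bar> else 0))" for x
    unfolding branch_weight_def by (rule sum_ennreal[symmetric]) simp
  have "AE x in unit_leb. ennreal (branch_weight x) = 1"
  proof (rule density_unique_finite_measure)
    show "(\<lambda>x. ennreal (branch_weight x)) \<in> borel_measurable unit_leb"
      using branch_weight_measurable by measurable
    fix A assume "A \<in> sets unit_leb"
    then have A: "A \<in> sets lebesgue" "A \<subseteq> {0..1}"
      by (auto simp: sets_restrict_space)
    have m: "(\<lambda>x. ennreal (if inv_branch J x \<in> J then 1 / \<bar>a J\<bar> else 0) * indicator A x)
        \<in> borel_measurable unit_leb" if "J \<in> P" for J
    proof -
      have "(\<lambda>x. if inv_branch J x \<in> J then 1 / \<bar>a J\<bar> else 0) \<in> borel_measurable unit_leb"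
        using inv_branch_measurable[OF that]
        by (intro measurable_restrict_space1 measurable_completion measurable_If) auto
      with \<open>A \<in> sets unit_leb\<close> show ?thesis
        by measurable
    qed
    have "(\<integral>\<^sup>+x. ennreal (branch_weight x) * indicator A x \<partial>unit_leb)
        = (\<integral>\<^sup>+x. (\<Sum>J\<in>P. ennreal (if inv_branch J x \<in> J then 1 / \<bar>a J\<bar> else 0) * indicator A x) \<partial>unit_leb)"
      by (simp only: weight sum_distrib_right)
    also have "\<dots> = (\<Sum>J\<in>P. emeasure lebesgue (J \<inter> T -` A))"
      using A by (subst nn_integral_sum[OF m]) (auto simp: branch_nn_integral)
    also have "\<dots> = emeasure lebesgue (\<Union>J\<in>P. J \<inter> T -` A)"
    proof (rule sum_emeasure)
      have "J \<inter> T -` A = J \<inter> (T -` A \<inter> space (lebesgue_on (\<Union>P)))" if "J \<in> P" for J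
        using that by auto
      moreover have "T -` A \<inter> space (lebesgue_on (\<Union>P)) \<in> sets lebesgue"
        using measurable_sets[OF T_measurable \<open>A \<in> sets unit_leb\<close>] UP_sets
        by (subst (asm) sets_restrict_space_iff) auto
      ultimately show "(\<lambda>J. J \<inter> T -` A) ` P \<subseteq> sets lebesgue"
        using branch_open by auto
      show "disjoint_family_on (\<lambda>J. J \<inter> T -` A) P"
        by (auto simp: disjoint_family_on_def dest: branch_unique)
    qed (rule finite_P)
    also have "(\<Union>J\<in>P. J \<inter> T -` A) = T -` A \<inter> space (lebesgue_on (\<Union>P))"
      by auto
    also have "emeasure lebesgue \<dots> = emeasure (lebesgue_on (\<Union>P)) \<dots>"
      using UP_sets by (subst emeasure_restrict_space) auto
    also have "\<dots> = emeasure unit_leb A"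
      using emeasure_distr[OF T_measurable \<open>A \<in> sets unit_leb\<close>] by (simp add: distr_T)
    finally show "(\<integral>\<^sup>+x. ennreal (branch_weight x) * indicator A x \<partial>unit_leb)
        = (\<integral>\<^sup>+x. 1 * indicator A x \<partial>unit_leb)"
      using \<open>A \<in> sets unit_leb\<close> by simp
  qed auto
  then show ?thesis
    by (rule eventually_mono) (simp add: ennreal_eq_1)
qed

end

subsection \<open>The Koopman operator and the kernel of the transfer operator\<close>

inductive interval_sum :: "nat \<Rightarrow> L1 \<Rightarrow> bool" where
  interval_sum_0: "interval_sum 0 0"
| interval_sum_1: "is_interval K \<Longrightarrow> K \<subseteq> {0..1} \<Longrightarrow> interval_sum 1 (L1_class (indicator K))"
| interval_sum_add: "interval_sum m f \<Longrightarrow> interval_sum n g \<Longrightarrow> interval_sum (m + n) (f + g)"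

lemma interval_sum_sum:
  assumes "finite A" and "\<And>i. i \<in> A \<Longrightarrow> interval_sum 1 (h i)"
  shows "interval_sum (card A) (sum h A)"
  using assms
proof (induction rule: finite_induct)
  case (insert x F)
  then have "interval_sum (1 + card F) (h x + sum h F)"
    by (intro interval_sum_add) auto
  with insert show ?case by simp
qed (simp add: interval_sum_0)

context expanding_affine_map
begin

text \<open>The value 0 off the branches is a default on a finite subset of the unit interval,
  invisible in \<open>L1\<close>.\<close>

definition koopman_fun :: "(real \<Rightarrow> complex) \<Rightarrow> real \<Rightarrow> complex" where
  "koopman_fun f x = (if x \<in> \<Union>P then f (T x) else 0)"

definition koopman :: "L1 \<Rightarrow> L1" where
  "koopman \<phi> = L1_class (koopman_fun (rep_L1 \<phi>))"

lemma
  assumes f: "integrable unit_leb f"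
  shows koopman_fun_integrable: "integrable unit_leb (koopman_fun f)"
    and koopman_fun_norm: "(LINT x|unit_leb. cmod (koopman_fun f x)) = (LINT x|unit_leb. cmod (f x))"
proof -
  have sets: "\<Union>P \<inter> space lebesgue \<in> sets lebesgue"
    using UP_sets by simp
  have "integrable (distr (lebesgue_on (\<Union>P)) unit_leb T) f"
    using f by (simp add: distr_T)
  then have "integrable (lebesgue_on (\<Union>P)) (\<lambda>x. f (T x))"
    by (rule integrable_distr[OF T_measurable])
  then have "integrable lebesgue (\<lambda>x. indicator (\<Union>P) x *\<^sub>R f (T x))"
    unfolding integrable_restrict_space[OF sets] .
  moreover have "(\<lambda>x. indicator (\<Union>P) x *\<^sub>R f (T x)) = koopman_fun f"
    by (auto simp: koopman_fun_def indicator_def)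
  ultimately show "integrable unit_leb (koopman_fun f)"
    using integrable_unit_lebI by metis
  have "(LINT x|unit_leb. cmod (koopman_fun f x)) = (LINT x|lebesgue. indicator {0..1} x *\<^sub>R cmod (koopman_fun f x))"
    by (rule integral_restrict_space) simp
  also have "\<dots> = (LINT x|lebesgue. indicator (\<Union>P) x *\<^sub>R cmod (f (T x)))"
    using UP_subset by (intro Bochner_Integration.integral_cong) (auto simp: koopman_fun_def indicator_def)
  also have "\<dots> = (LINT x|lebesgue_on (\<Union>P). cmod (f (T x)))"
    by (rule integral_restrict_space[OF sets, symmetric])
  also have "\<dots> = (LINT x|distr (lebesgue_on (\<Union>P)) unit_leb T. cmod (f x))"
    using f by (intro integral_distr[OF T_measurable, symmetric]) auto
  finally show "(LINT x|unit_leb. cmod (koopman_fun f x)) = (LINT x|unit_leb. cmod (f x))"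
    by (simp add: distr_T)
qed

text \<open>By invariance, preimages of null sets under \<open>T\<close> are null; hence
  \<open>koopman\<close> does not depend on the representative.\<close>

lemma koopman_fun_cong_AE:
  assumes "AE x in unit_leb. f x = g x"
  shows "AE x in unit_leb. koopman_fun f x = koopman_fun g x"
proof -
  have "AE x in lebesgue_on (\<Union>P). f (T x) = g (T x)"
    by (rule AE_distrD[OF T_measurable]) (unfold distr_T, rule assms)
  then show ?thesis
    using UP_sets unfolding AE_unit_leb_iff
    by (subst (asm) AE_restrict_space_iff) (auto elim!: eventually_mono simp: koopman_fun_def)
qed

lemma koopman_class:
  "integrable unit_leb f \<Longrightarrow> koopman (L1_class f) = L1_class (koopman_fun f)"
  unfolding koopman_def
  by (simp add: L1_class_eq_iff koopman_fun_integrable integrable_rep_L1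
      koopman_fun_cong_AE[OF rep_L1_class])

lemma koopman_add: "koopman (\<phi> + \<psi>) = koopman \<phi> + koopman \<psi>"
proof -
  let ?f = "rep_L1 \<phi>" and ?g = "rep_L1 \<psi>"
  have "koopman (L1_class ?f + L1_class ?g) = L1_class (koopman_fun (\<lambda>x. ?f x + ?g x))"
    by (simp add: L1_class_add[symmetric] integrable_rep_L1 koopman_class)
  also have "koopman_fun (\<lambda>x. ?f x + ?g x) = (\<lambda>x. koopman_fun ?f x + koopman_fun ?g x)"
    by (simp add: koopman_fun_def fun_eq_iff)
  finally show ?thesis
    by (simp add: L1_class_add koopman_fun_integrable integrable_rep_L1 L1_class_rep koopman_def)
qed

lemma koopman_scale: "koopman (c *\<^sub>C \<phi>) = c *\<^sub>C koopman \<phi>"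
proof -
  let ?f = "rep_L1 \<phi>"
  have "koopman (c *\<^sub>C L1_class ?f) = L1_class (koopman_fun (\<lambda>x. c * ?f x))"
    by (simp add: L1_class_scale[symmetric] integrable_rep_L1 koopman_class)
  also have "koopman_fun (\<lambda>x. c * ?f x) = (\<lambda>x. c * koopman_fun ?f x)"
    by (simp add: koopman_fun_def fun_eq_iff)
  finally show ?thesis
    by (simp add: L1_class_scale koopman_fun_integrable integrable_rep_L1 L1_class_rep koopman_def)
qed

lemma koopman_norm: "L1_norm (koopman \<phi>) = L1_norm \<phi>"
proof -
  have "L1_norm (koopman \<phi>) = L1_norm (L1_class (rep_L1 \<phi>))"
    unfolding koopman_def
    by (simp only: L1_norm_class koopman_fun_integrable integrable_rep_L1 koopman_fun_norm)
  then show ?thesis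
    by (simp add: L1_class_rep)
qed

text \<open>The composition with \<open>T\<close> is constant on the fibre over \<open>x\<close> and
  leaves the sum. Together with \<open>AE_branch_weight\<close> this makes \<open>koopman\<close> a
  right inverse of the transfer operator.\<close>

lemma transfer_koopman_fun: "transfer_fun (koopman_fun f) x = f x * branch_weight x"
proof -
  have "T (inv_branch J x) = x" if "J \<in> P" "inv_branch J x \<in> J" for J
    using inv_branch_iff[OF that(1), of "inv_branch J x" x] that(2) by simp
  then show ?thesis
    unfolding transfer_fun_eq branch_weight_def of_real_sum sum_distrib_left
    by (intro sum.cong) (auto simp: koopman_fun_def)
qed

lemma transfer_operator_koopman: "transfer_operator P T (koopman \<phi>) = \<phi>"
proof -
  let ?f = "rep_L1 \<phi>"
  have "transfer_operator P T (koopman \<phi>) = L1_class (transfer_fun (koopman_fun ?f))"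
    unfolding koopman_def by (intro transfer_operator_class koopman_fun_integrable integrable_rep_L1)
  also have "\<dots> = L1_class ?f"
    using AE_branch_weight
    by (subst L1_class_eq_iff)
      (auto intro: transfer_fun_integrable koopman_fun_integrable integrable_rep_L1
        elim!: eventually_mono simp: transfer_koopman_fun)
  finally show ?thesis
    by (simp add: L1_class_rep)
qed

lemma branch_preimage_interval:
  assumes "J \<in> P" "is_interval K"
  shows "is_interval (J \<inter> T -` K)"
  unfolding is_interval_1
proof (intro ballI allI impI)
  fix x y z assume xy: "x \<in> J \<inter> T -` K" "y \<in> J \<inter> T -` K" and z: "x \<le> z \<and> z \<le> y"
  obtain l u where "J = {l<..<u}"
    by (rule branch_interval[OF assms(1)])
  then have "z \<in> J"
    using xy z by auto
  \<comment> \<open>An affine map is monotone in one direction or the other, according to the sign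
    of its slope.\<close>
  moreover have "T x \<le> T z \<and> T z \<le> T y \<or> T y \<le> T z \<and> T z \<le> T x"
    using xy z \<open>z \<in> J\<close> T_affine[OF assms(1)]
    by (cases "0 \<le> a J") (auto simp: mult_left_mono mult_left_mono_neg)
  then have "T z \<in> K"
    using xy assms(2) unfolding is_interval_1 by blast
  ultimately show "z \<in> J \<inter> T -` K"
    by simp
qed

lemma koopman_indicator:
  assumes "is_interval K" "K \<subseteq> {0..1}"
  shows "koopman (L1_class (indicator K)) = (\<Sum>J\<in>P. L1_class (indicator (J \<inter> T -` K)))"
proof -
  have sets: "M \<in> sets lebesgue" if "is_interval M" for M :: "real set"
    using real_interval_borel_measurable[OF that] by simp
  have "koopman_fun (indicator K) x = (\<Sum>J\<in>P. indicator (J \<inter> T -` K) x)" for x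
  proof (cases "x \<in> \<Union>P")
    case True
    then obtain J where J: "J \<in> P" "x \<in> J" by blast
    have "(\<Sum>J\<in>P. indicator (J \<inter> T -` K) x :: complex) = (\<Sum>J\<in>{J}. indicator (J \<inter> T -` K) x)"
      using J finite_P by (intro sum.mono_neutral_right) (auto simp: indicator_def dest: branch_unique)
    with True J show ?thesis
      by (simp add: koopman_fun_def indicator_def)
  next
    case False
    then show ?thesis
      by (auto simp: koopman_fun_def indicator_def intro!: sum.neutral[symmetric])
  qed
  then have "koopman_fun (indicator K) = (\<lambda>x. \<Sum>J\<in>P. indicator (J \<inter> T -` K) x)"
    by (rule ext)
  then have "koopman (L1_class (indicator K)) = L1_class (\<lambda>x. \<Sum>J\<in>P. indicator (J \<inter> T -` K) x)"
    using assms by (simp add: koopman_class integrable_indicator_unit_leb sets)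
  also have "\<dots> = (\<Sum>J\<in>P. L1_class (indicator (J \<inter> T -` K)))"
    using assms by (intro L1_class_sum integrable_indicator_unit_leb sets branch_preimage_interval)
  finally show ?thesis .
qed

text \<open>Every interval has one interval as preimage in each branch. This factor
  \<open>card P\<close> is the growth rate behind the radius \<open>1 / k\<close>.\<close>

lemma interval_sum_koopman: "interval_sum m f \<Longrightarrow> interval_sum (m * card P) (koopman f)"
proof (induction rule: interval_sum.induct)
  case interval_sum_0
  then show ?case
    using koopman_add[of 0 0] by (simp add: interval_sum.interval_sum_0)
next
  case (interval_sum_1 K)
  then show ?case
    using branch_subset
    by (auto simp: koopman_indicator
        intro!: interval_sum_sum finite_P interval_sum.interval_sum_1 branch_preimage_interval)
next
  case (interval_sum_add m f n g)
  then show ?case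
    by (simp add: koopman_add add_mult_distrib interval_sum.interval_sum_add)
qed

lemma interval_sum_koopman_pow:
  assumes "is_interval K" "K \<subseteq> {0..1}"
  shows "interval_sum (card P ^ n) ((koopman ^^ n) (L1_class (indicator K)))"
proof (induction n)
  case 0
  then show ?case
    using interval_sum_1[OF assms] by simp
next
  case (Suc n)
  from interval_sum_koopman[OF this] show ?case
    by (simp add: mult.commute)
qed

section \<open>Infinitely many independent kernel elements\<close>

text \<open>At a point of total weight 1 at least two branches contribute, since each weight is
  below 1. Membership in both images is an open condition, so an interval of such points
  exists.\<close>

lemma overlapping_branches:
  obtains I J x e where "I \<in> P" "J \<in> P" "I \<noteq> J" "0 < e" "{x<..<x + e} \<subseteq> T ` I \<inter> T ` J"
proof -
  \<comment> \<open>The unit interval has positive measure, so a property valid almost everywhere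
    holds somewhere.\<close>
  have "\<exists>x. branch_weight x = 1"
  proof (rule ccontr)
    assume "\<nexists>x. branch_weight x = 1"
    then have "AE x in unit_leb. False"
      using AE_branch_weight by simp
    then have "emeasure unit_leb (space unit_leb) = 0"
      by (simp only: eventually_False ae_filter_eq_bot_iff)
    then show False
      by (simp add: emeasure_restrict_space)
  qed
  then obtain x where x: "branch_weight x = 1" ..
  have "\<exists>I\<in>P. inv_branch I x \<in> I"
  proof (rule ccontr)
    assume "\<not> (\<exists>I\<in>P. inv_branch I x \<in> I)"
    then have "branch_weight x = 0"
      unfolding branch_weight_def by (intro sum.neutral) auto
    with x show False by simp
  qed
  then obtain I where I: "I \<in> P" "inv_branch I x \<in> I" by blast
  have "\<exists>J\<in>P. J \<noteq> I \<and> inv_branch J x \<in> J"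
  proof (rule ccontr)
    assume "\<not> (\<exists>J\<in>P. J \<noteq> I \<and> inv_branch J x \<in> J)"
    then have "branch_weight x = (\<Sum>J\<in>{I}. if inv_branch J x \<in> J then 1 / \<bar>a J\<bar> else 0)"
      unfolding branch_weight_def using I finite_P by (intro sum.mono_neutral_right) auto
    with x I expanding[OF I(1)] show False by simp
  qed
  then obtain J where J: "J \<in> P" "J \<noteq> I" "inv_branch J x \<in> J" by blast
  define O' where "O' = {y. inv_branch I y \<in> I} \<inter> {y. inv_branch J y \<in> J}"
  have "open O'"
    unfolding O'_def inv_branch_def using I J
    by (intro open_Int open_vimage[OF branch_open, unfolded vimage_def])
      (auto intro!: continuous_intros dest: slope_nonzero)
  moreover have "x \<in> O'"
    using I J by (simp add: O'_def)
  ultimately obtain e where e: "0 < e" "ball x e \<subseteq> O'"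
    by (meson open_contains_ball)
  have "O' \<subseteq> T ` I \<inter> T ` J"
  proof
    fix y assume "y \<in> O'"
    then show "y \<in> T ` I \<inter> T ` J"
      using inv_branch_iff[OF I(1), of "inv_branch I y" y] inv_branch_iff[OF J(1), of "inv_branch J y" y]
      by (simp add: O'_def image_iff) metis
  qed
  moreover have "{x<..<x + e} \<subseteq> ball x e"
    by (auto simp: dist_real_def)
  ultimately show thesis
    using e I J by (intro that[of I J e x]) auto
qed

text \<open>Multiplication by the slope undoes the weight, so both terms of \<open>g i\<close> are
  mapped to the indicator of \<open>K i\<close> and cancel. For independence, on the part of
  \<open>I\<close> lying over \<open>K i\<close> only \<open>g i\<close> is nonzero.\<close>

lemma kernel_sequence:
  fixes K :: "nat \<Rightarrow> real set"
  assumes IJ: "I \<in> P" "J \<in> P" "I \<noteq> J"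
    and K: "\<And>i. open (K i)" "\<And>i. K i \<noteq> {}" "\<And>i. is_interval (K i)" "\<And>i. K i \<subseteq> T ` I \<inter> T ` J"
    and disj: "\<And>i j y. y \<in> K i \<Longrightarrow> y \<in> K j \<Longrightarrow> i = j"
  defines "g \<equiv> \<lambda>i. complex_of_real \<bar>a I\<bar> *\<^sub>C L1_class (indicator (I \<inter> T -` K i))
                 - complex_of_real \<bar>a J\<bar> *\<^sub>C L1_class (indicator (J \<inter> T -` K i))"
  shows "transfer_operator P T (g i) = 0"
    and "(\<Sum>j<n. c j *\<^sub>C g j) = 0 \<Longrightarrow> i < n \<Longrightarrow> c i = 0"
proof -
  interpret Vector_Spaces.linear scaleC scaleC "transfer_operator P T"
    by unfold_locales (auto simp: transfer_operator_add transfer_operator_scale)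
  have int: "integrable unit_leb (indicator (M \<inter> T -` K i) :: real \<Rightarrow> complex)" if "M \<in> P" for M i
    using branch_preimage_interval[OF that K(3)] real_interval_borel_measurable
    by (intro integrable_indicator_unit_leb) auto
  have "complex_of_real \<bar>a M\<bar> *\<^sub>C transfer_operator P T (L1_class (indicator (M \<inter> T -` K i))) = L1_class (indicator (K i))"
    if M: "M \<in> P" "K i \<subseteq> T ` M" for M
  proof -
    have "complex_of_real \<bar>a M\<bar> *\<^sub>C transfer_operator P T (L1_class (indicator (M \<inter> T -` K i)))
      = L1_class (\<lambda>x. complex_of_real \<bar>a M\<bar> * transfer_fun (indicator (M \<inter> T -` K i)) x)"
      by (simp add: transfer_operator_class int M L1_class_scale transfer_fun_integrable)
    also have "(\<lambda>x. complex_of_real \<bar>a M\<bar> * transfer_fun (indicator (M \<inter> T -` K i)) x) = indicator (K i)"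
      using slope_nonzero[OF M(1)] by (simp add: transfer_indicator[OF M] fun_eq_iff)
    finally show ?thesis .
  qed
  from this[of I] this[of J] show "transfer_operator P T (g i) = 0"
    using IJ K(4)[of i] unfolding g_def by (simp only: diff scale) simp
  define F where "F j x = of_real \<bar>a I\<bar> * indicator (I \<inter> T -` K j) x
      - of_real \<bar>a J\<bar> * (indicator (J \<inter> T -` K j) x :: complex)" for j x
  have F_int: "integrable unit_leb (F j)" for j
    unfolding F_def[abs_def] using int IJ
    by (intro Bochner_Integration.integrable_diff integrable_mult_right) auto
  have g_F: "g j = L1_class (F j)" for j
    unfolding g_def F_def[abs_def] using int IJ
    by (simp add: L1_class_diff L1_class_scale)
  assume 0: "(\<Sum>j<n. c j *\<^sub>C g j) = 0" and i: "i < n"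
  have "(\<Sum>j<n. c j *\<^sub>C g j) = L1_class (\<lambda>x. \<Sum>j<n. c j * F j x)"
    by (simp add: g_F F_int L1_class_scale L1_class_sum)
  then have "L1_class (\<lambda>x. \<Sum>j<n. c j * F j x) = L1_class (\<lambda>_. 0)"
    by (simp add: 0 L1_class_zero)
  then have "AE x in unit_leb. (\<Sum>j<n. c j * F j x) = 0"
    by (subst (asm) L1_class_eq_iff) (auto intro!: Bochner_Integration.integrable_sum F_int)
  then have AE: "AE x in lebesgue. x \<in> {0..1} \<longrightarrow> (\<Sum>j<n. c j * F j x) = 0"
    by (simp only: AE_unit_leb_iff)
  \<comment> \<open>Nonempty open sets are not null, so the almost-everywhere identity can be
    evaluated at a point of this set.\<close>
  have A: "\<not> negligible (I \<inter> T -` K i)"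
  proof (rule open_not_negligible)
    have "I \<inter> T -` K i = I \<inter> (\<lambda>x. a I * x + b I) -` K i"
      using T_affine[OF IJ(1)] by auto
    also have "open \<dots>"
      by (intro open_Int branch_open IJ open_vimage K continuous_intros)
    finally show "open (I \<inter> T -` K i)" .
    show "I \<inter> T -` K i \<noteq> {}"
      using K(2,4)[of i] by blast
  qed
  have "\<exists>x\<in>I \<inter> T -` K i. (\<Sum>j<n. c j * F j x) = 0"
  proof (rule ccontr)
    assume "\<not> (\<exists>x\<in>I \<inter> T -` K i. (\<Sum>j<n. c j * F j x) = 0)"
    with AE have "AE x in lebesgue. x \<notin> I \<inter> T -` K i"
      using branch_subset[OF IJ(1)] by (auto elim!: eventually_mono)
    moreover have "I \<inter> T -` K i \<in> sets lebesgue"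
      using real_interval_borel_measurable[OF branch_preimage_interval[OF IJ(1) K(3)]] by simp
    ultimately have "negligible (I \<inter> T -` K i)"
      by (simp add: negligible_iff_null_sets AE_iff_null_sets)
    with A show False ..
  qed
  then obtain x where x: "x \<in> I" "T x \<in> K i" "(\<Sum>j<n. c j * F j x) = 0"
    by auto
  have "x \<notin> J"
    using x(1) IJ branch_unique by blast
  \<comment> \<open>At \<open>x\<close> the first indicator selects \<open>i\<close> by disjointness
    of the \<open>K j\<close>, and the second vanishes because \<open>x \<notin> J\<close>.\<close>
  have "(\<Sum>j<n. c j * F j x) = (\<Sum>j\<in>{i}. c j * F j x)"
    using i x disj \<open>x \<notin> J\<close> by (intro sum.mono_neutral_right) (auto simp: F_def indicator_def)
  then show "c i = 0"
    using x \<open>x \<notin> J\<close> slope_nonzero[OF IJ(1)] by (simp add: F_def)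
qed

end

section \<open>Choice of intervals and conclusion\<close>

text \<open>Consecutive intervals share an endpoint and, being open, stay disjoint. The offsets 1
  and 2 keep the denominators positive at \<open>i = 0\<close>.\<close>

lemma shrinking_intervals:
  fixes x e :: real
  assumes "0 < e"
  defines "K \<equiv> \<lambda>i::nat. {x + e / (real i + 2)<..<x + e / (real i + 1)}"
  shows "K i \<noteq> {}" and "K i \<subseteq> {x<..<x + e}" and "y \<in> K i \<Longrightarrow> y \<in> K j \<Longrightarrow> i = j"
proof -
  have "e / (real i + 2) < e / (real i + 1)"
    using assms by (intro divide_strict_left_mono) auto
  then show "K i \<noteq> {}"
    by (simp add: K_def)
  have "0 < e / (real i + 2)" "e / (real i + 1) \<le> e"
    using assms by (auto simp: field_simps)
  then show "K i \<subseteq> {x<..<x + e}"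
    by (auto simp: K_def)
  have *: "\<not> (y \<in> K i \<and> y \<in> K j)" if "i < j" for i j
  proof -
    have "e / (real j + 1) \<le> e / (real i + 2)"
      using assms that by (intro divide_left_mono) auto
    then show ?thesis
      by (auto simp: K_def)
  qed
  show "y \<in> K i \<Longrightarrow> y \<in> K j \<Longrightarrow> i = j"
    using *[of i j] *[of j i] by (cases i j rule: linorder_cases) auto
qed

theorem theorem2:
  fixes P :: "real set set" and T :: "real \<Rightarrow> real" and k :: nat
    and B :: "L1 set" and N :: "L1 \<Rightarrow> real" and C :: real
  assumes "piecewise_expanding P T"
    and "lebesgue_invariant P T"
    and "piecewise_affine P T"
    and "k = card P"
    and "banach_function_space B N"
    and "transfer_operator P T ` B \<subseteq> B"
    and "bounded_on B N (transfer_operator P T)"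
    and "0 \<le> C"
    and "\<And>J. is_interval J \<Longrightarrow> J \<subseteq> {0..1} \<Longrightarrow>
           L1_class (indicator J) \<in> B \<and> N (L1_class (indicator J)) \<le> C"
  shows "ereal (1 / real k) \<le> ess_spectral_radius B N (transfer_operator P T) \<and>
         (\<forall>z::complex. cmod z < 1 / real k \<longrightarrow>
            eigenvalue_on B (transfer_operator P T) z \<and>
            \<not> finite_dim (eigenspace_on B (transfer_operator P T) z))"
proof -
  let ?L = "transfer_operator P T"
  obtain a b where ab: "\<And>J x. J \<in> P \<Longrightarrow> x \<in> J \<Longrightarrow> T x = a J * x + b J"
    using assms(3) unfolding piecewise_affine_def by metis
  have part: "open_interval_partition P"
    using assms(1) by (auto simp: piecewise_expanding_def)
  obtain c where c: "1 < c" "\<And>x. x \<in> \<Union>P \<Longrightarrow> c \<le> \<bar>deriv T x\<bar>"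
    using assms(1) unfolding piecewise_expanding_def by blast
  have "1 < \<bar>a J\<bar>" if J: "J \<in> P" for J
  proof -
    obtain l u where lu: "l < u" "J = {l<..<u}"
      using part J by (auto simp: open_interval_partition_def)
    \<comment> \<open>Any point of the branch would do for reading off its slope; the midpoint is a
      witness.\<close>
    then have "(l + u) / 2 \<in> J"
      by (simp add: field_simps)
    then obtain x where x: "x \<in> J" ..
    have "deriv T x = a J"
      using lu x ab[OF J] by (intro deriv_affine_on_open[of J]) auto
    then show ?thesis
      using c(1) c(2)[of x] x J by fastforce
  qed
  then interpret expanding_affine_map P T a b
    using part ab assms(2) by unfold_locales
  interpret transfer_koopman B N ?L koopman
    using assms(5,6,7)
    by unfold_locales
      (auto simp: transfer_operator_add transfer_operator_scale koopman_add koopman_scale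
        koopman_norm transfer_operator_koopman)
  \<comment> \<open>The uniform bound \<open>C\<close> on indicators and the triangle inequality
    turn the number of intervals into a norm bound.\<close>
  have bound: "f \<in> B \<and> N f \<le> C * real m" if "interval_sum m f" for m f
    using that
  proof (induction rule: interval_sum.induct)
    case interval_sum_0
    then show ?case
      using B_zero N_eq_0[OF B_zero] by simp
  next
    case (interval_sum_1 K)
    then show ?case
      using assms(9) by simp
  next
    case (interval_sum_add m f n g)
    then show ?case
      using N_triangle[of f g] by (auto intro: B_add simp: algebra_simps)
  qed
  obtain I J x e where IJ: "I \<in> P" "J \<in> P" "I \<noteq> J" and "0 < e"
    and sub: "{x<..<x + e} \<subseteq> T ` I \<inter> T ` J"
    by (rule overlapping_branches)
  define K where "K i = {x + e / (real i + 2)<..<x + e / (real i + 1)}" for i :: nat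
  have K: "open (K i)" "K i \<noteq> {}" "is_interval (K i)" "K i \<subseteq> T ` I \<inter> T ` J" for i
    using shrinking_intervals(1,2)[OF \<open>0 < e\<close>, of x i] sub
    by (auto simp: K_def is_interval_1)
  have disj: "i = j" if "y \<in> K i" "y \<in> K j" for i j y
    using shrinking_intervals(3)[OF \<open>0 < e\<close>] that unfolding K_def by blast
  define h where "h M i = L1_class (indicator (M \<inter> T -` K i))" for M i
  define g where "g i = complex_of_real \<bar>a I\<bar> *\<^sub>C h I i - complex_of_real \<bar>a J\<bar> *\<^sub>C h J i" for i
  note ker = kernel_sequence[of I J K, OF IJ K disj, folded h_def, folded g_def]
  have h: "(koopman ^^ n) (h M i) \<in> B" "N ((koopman ^^ n) (h M i)) \<le> C * real k ^ n"
    if "M \<in> P" for M i n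
    using bound[OF interval_sum_koopman_pow[of "M \<inter> T -` K i" n]] branch_preimage_interval[OF that K(3)]
      branch_subset[OF that] assms(4) unfolding h_def by auto
  \<comment> \<open>The minus sign is absorbed into the scalar, which brings the expression into the
    form required by \<open>N_triangle\<close> and \<open>N_scale\<close>.\<close>
  have pow_g: "(koopman ^^ n) (g i) = complex_of_real \<bar>a I\<bar> *\<^sub>C (koopman ^^ n) (h I i)
      + (- complex_of_real \<bar>a J\<bar>) *\<^sub>C (koopman ^^ n) (h J i)" for n i
    by (induction n) (simp_all add: g_def koopman_add koopman_scale del: L1.scale_minus_left
        add: L1.scale_minus_left[symmetric])
  have g_B: "(koopman ^^ n) (g i) \<in> B" for n i
    unfolding pow_g by (intro B_add B_scale h IJ)
  have g_N: "N ((koopman ^^ n) (g i)) \<le> ((\<bar>a I\<bar> + \<bar>a J\<bar>) * C) * real k ^ n" for n i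
  proof -
    have "N ((koopman ^^ n) (g i)) \<le> \<bar>a I\<bar> * N ((koopman ^^ n) (h I i)) + \<bar>a J\<bar> * N ((koopman ^^ n) (h J i))"
      unfolding pow_g
      by (rule order_trans[OF N_triangle]) (simp_all only: B_scale h IJ N_scale norm_minus_cancel norm_of_real abs_abs order_refl)
    also have "\<dots> \<le> \<bar>a I\<bar> * (C * real k ^ n) + \<bar>a J\<bar> * (C * real k ^ n)"
      by (intro add_mono mult_left_mono h IJ) auto
    finally show ?thesis
      by (simp add: algebra_simps)
  qed
  have inf: "\<not> finite_dim (eigenspace_on B ?L z)" if z: "cmod z < 1 / real k" for z
  proof (rule eigenspace_infinite_dim[OF ker(1) g_B g_N])
    show "cmod z * real k < 1"
      \<comment> \<open>Clearing the denominator requires a nonzero \<open>k\<close>; for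
        \<open>k = 0\<close> the product is 0.\<close>
      using z by (cases "k = 0") (auto simp: field_simps)
    show "(\<Sum>j<n. c j *\<^sub>C g j) = 0 \<Longrightarrow> i < n \<Longrightarrow> c i = 0" for n c i
      by (rule ker(2))
    show "0 \<le> real k"
      by (rule of_nat_0_le_iff)
  qed
  have "L1.subspace B"
    using assms(5) by (simp add: banach_function_space_def)
  note ess_spectral_radius_ge[where \<rho> = "1 / real k", OF this _ transfer_operator_add inf]
  with inf show ?thesis
    by simp
qed

end
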